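(* Let $\mathbb{X}$ be a Polish space, let $\mathcal{B}_b\subseteq\mathcal{B}(\mathbb{X})$ be a boundedness which properly localizes $\mathbb{X}$, and let $(K_m)_{m\in\mathbb{N}}$ be a proper localizing sequence for $\mathcal{B}_b$. Let $N,N_1,N_2,\dots$ be random measures on $\mathbb{X}$. Let $\mathcal{C}\subseteq CB_b^+(\mathbb{X})$ be such that (i) $\alpha f+\beta g\in\mathcal{C}$ and $f\cdot g\in\mathcal{C}$ for all $f,g\in\mathcal{C}$ and $\alpha,\beta\ge 0$; (ii) the family $\mathcal{C}$ induces the topology of $\mathbb{X}$, i.e. the sets $f^{-1}(U)$, for $U\subseteq\mathbb{R}_+=[0,\infty)$ open and $f\in\mathcal{C}$, form a subbase for the original topology on $\mathbb{X}$; (iii) for every $m\in\mathbb{N}$ there exist $\delta_m>0$ and $h_m\in\mathcal{C}$ such that $h_m\ge\delta_m\mathbf{1}_{K_m}$. Then $N_n$ converges in distribution to $N$ in $\mathcal{M}(\mathbb{X})$ (with respect to the vague topology) as $n\to\infty$ if and only if $$\mathbb{E}[e^{-N_n(f)}]\to\mathbb{E}[e^{-N(f)}]\quad\text{as } n\to\infty,\ \text{for every } f\in\mathcal{C}.$$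
   Context: A Polish space is a separable topological space which is metrizable by a complete metric; $\mathcal{B}(\mathbb{X})$ denotes the Borel $\sigma$-field of $\mathbb{X}$. A family $\mathcal{B}_b\subseteq\mathcal{B}(\mathbb{X})$ is a (Borel) boundedness in $\mathbb{X}$ if (i) $A\subseteq B\in\mathcal{B}_b$ with $A\in\mathcal{B}(\mathbb{X})$ implies $A\in\mathcal{B}_b$, and (ii) $A,B\in\mathcal{B}_b$ implies $A\cup B\in\mathcal{B}_b$. The elements of $\mathcal{B}_b$ are called bounded sets. A subfamily $\mathcal{C}_b\subseteq\mathcal{B}_b$ is a basis of $\mathcal{B}_b$ if every $B\in\mathcal{B}_b$ is contained in some $C\in\mathcal{C}_b$. The boundedness $\mathcal{B}_b$ is proper if for each $B\in\mathcal{B}_b$ there exists an open set $U\in\mathcal{B}_b$ with $\overline{B}\subseteq U$, where $\overline{B}$ is the closure of $B$. It properly localizes $\mathbb{X}$ if it is proper and has a countable basis which covers $\mathbb{X}$. A proper localizing sequence for $\mathcal{B}_b$ is a sequence $(K_m)_{m\in\mathbb{N}}$ of open sets covering $\mathbb{X}$ with $\overline{K}_m\subseteq K_{m+1}$ for all $m\in\mathbb{N}$ and such that $\mathcal{B}_b=\{B\in\mathcal{B}(\mathbb{X}): B\subseteq K_m\text{ for some } m\in\mathbb{N}\}$. Such a sequence exists whenever $\mathcal{B}_b$ properly localizes $\mathbb{X}$. A Borel measure $\mu$ on $\mathbb{X}$ is locally finite if $\mu(B)<\infty$ for all $B\in\mathcal{B}_b$; $\mathcal{M}(\mathbb{X})=\mathcal{M}(\mathbb{X},\mathcal{B}_b)$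 is the set of all such measures. Write $\mu(f)=\int f\,d\mu$. $CB_b^+(\mathbb{X})$ is the family of all nonnegative, bounded, continuous real-valued functions on $\mathbb{X}$ whose support is a bounded set (i.e. belongs to $\mathcal{B}_b$). The vague topology on $\mathcal{M}(\mathbb{X})$ is the smallest topology under which the maps $\mu\mapsto\mu(f)$ are continuous for all $f\in CB_b^+(\mathbb{X})$. A random measure on $\mathbb{X}$ is a random element in $\mathcal{M}(\mathbb{X})$ with respect to the smallest $\sigma$-algebra under which the maps $\mu\mapsto\mu(B)$ are measurable for all $B\in\mathcal{B}_b$; this $\sigma$-algebra equals the Borel $\sigma$-algebra of the vague topology. Convergence in distribution in $\mathcal{M}(\mathbb{X})$ is considered with respect to the vague topology. $\mathbf{1}_{A}$ denotes the indicator function of $A$. *)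

theory Defs
  imports "HOL-Probability.Probability"
begin

text \<open>
  The Polish space is the universe of a type of class \<open>polish_space\<close>; the distance carried by
  the class is never used, only the topology and its Borel sets.
\<close>

definition boundedness :: "'a::topological_space set set \<Rightarrow> bool" where
  "boundedness Bb \<longleftrightarrow>
     Bb \<subseteq> sets borel \<and>
     (\<forall>A B. A \<in> sets borel \<longrightarrow> A \<subseteq> B \<longrightarrow> B \<in> Bb \<longrightarrow> A \<in> Bb) \<and>
     (\<forall>A B. A \<in> Bb \<longrightarrow> B \<in> Bb \<longrightarrow> A \<union> B \<in> Bb)"

definition boundedness_basis :: "'a set set \<Rightarrow> 'a set set \<Rightarrow> bool" where
  "boundedness_basis Bb Cb \<longleftrightarrow> Cb \<subseteq> Bb \<and> (\<forall>B\<in>Bb. \<exists>C\<in>Cb. B \<subseteq> C)"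

definition proper_boundedness :: "'a::topological_space set set \<Rightarrow> bool" where
  "proper_boundedness Bb \<longleftrightarrow>
     boundedness Bb \<and> (\<forall>B\<in>Bb. \<exists>U\<in>Bb. open U \<and> closure B \<subseteq> U)"

definition properly_localizes :: "'a::topological_space set set \<Rightarrow> bool" where
  "properly_localizes Bb \<longleftrightarrow>
     proper_boundedness Bb \<and>
     (\<exists>Cb. countable Cb \<and> boundedness_basis Bb Cb \<and> \<Union>Cb = UNIV)"

definition proper_localizing_sequence ::
    "'a::topological_space set set \<Rightarrow> (nat \<Rightarrow> 'a set) \<Rightarrow> bool" where
  "proper_localizing_sequence Bb K \<longleftrightarrow>
     (\<forall>m. open (K m)) \<and> (\<Union>m. K m) = UNIV \<and>
     (\<forall>m. closure (K m) \<subseteq> K (Suc m)) \<and>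
     Bb = {B \<in> sets borel. \<exists>m. B \<subseteq> K m}"

definition locally_finite_measures ::
    "'a::topological_space set set \<Rightarrow> 'a measure set" where
  "locally_finite_measures Bb =
     {\<mu>. sets \<mu> = sets borel \<and> (\<forall>B\<in>Bb. emeasure \<mu> B < \<infinity>)}"

definition CB_plus :: "'a::topological_space set set \<Rightarrow> ('a \<Rightarrow> real) set" where
  "CB_plus Bb =
     {f. (\<forall>x. 0 \<le> f x) \<and> bounded (range f) \<and> continuous_on UNIV f \<and>
         closure {x. f x \<noteq> 0} \<in> Bb}"

text \<open>
  For \<open>f \<in> CB_plus Bb\<close> and \<open>\<mu>\<close> locally finite, \<open>f\<close> is \<open>\<mu>\<close>-integrable, so the real-valued
  Bochner integral is the value \<open>\<mu>(f)\<close>.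
\<close>

definition vague_topology :: "'a::topological_space set set \<Rightarrow> 'a measure topology" where
  "vague_topology Bb = topology_generated_by
     {{\<mu> \<in> locally_finite_measures Bb. (\<integral>x. f x \<partial>\<mu>) \<in> U} | f U.
        f \<in> CB_plus Bb \<and> open U}"

text \<open>
  The measurable space \<open>\<M>(X)\<close>: as in the library's \<open>subprob_algebra\<close>, only the underlying
  set and the sigma-algebra of the supremum matter.
\<close>

definition locally_finite_algebra ::
    "'a::topological_space set set \<Rightarrow> 'a measure measure" where
  "locally_finite_algebra Bb =
     (SUP B\<in>Bb. vimage_algebra (locally_finite_measures Bb) (\<lambda>\<mu>. emeasure \<mu> B) borel)"

definition random_measure ::
    "'a::topological_space set set \<Rightarrow> 'w measure \<Rightarrow> ('w \<Rightarrow> 'a measure) \<Rightarrow> bool" where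
  "random_measure Bb P N \<longleftrightarrow> prob_space P \<and> N \<in> P \<rightarrow>\<^sub>M locally_finite_algebra Bb"

text \<open>
  Convergence in distribution of random elements of a topological space. The random elements
  may live on different probability spaces.
\<close>

definition converges_in_distribution ::
    "'b topology \<Rightarrow> (nat \<Rightarrow> 'w measure) \<Rightarrow> (nat \<Rightarrow> 'w \<Rightarrow> 'b) \<Rightarrow> 'v measure \<Rightarrow> ('v \<Rightarrow> 'b) \<Rightarrow> bool"
  where
  "converges_in_distribution T Ps Xs P X \<longleftrightarrow>
     (\<forall>\<phi>. continuous_map T euclideanreal \<phi> \<longrightarrow> bounded (\<phi> ` topspace T) \<longrightarrow>
        (\<lambda>n. \<integral>\<omega>. \<phi> (Xs n \<omega>) \<partial>Ps n) \<longlonglongrightarrow> (\<integral>\<omega>. \<phi> (X \<omega>) \<partial>P))"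

end

theory Submission
  imports Defs
begin

text \<open>
  One principle is used twice. Let countably many bounded functions \<open>g i\<close> on a set be such that all
  mixed moments of the \<open>g i\<close> converge along a sequence of finite measures. By Stone--Weierstrass the
  integrals of continuous functions of finitely many \<open>g i\<close> converge; and every nonnegative bounded
  \<open>\<phi>\<close> that is sequentially continuous for the topology induced by the \<open>g i\<close> is an increasing limit
  of such functions, so the integrals of \<open>\<phi>\<close> satisfy the liminf inequality. Applying this to
  \<open>c + \<phi>\<close> and \<open>c - \<phi>\<close> gives convergence, and no tightness argument is needed because the limit is
  given.

  On \<open>X\<close>, a countable part of \<open>\<C>\<close> generates the topology, and the principle for the finite measures
  \<open>h\<^sub>m \<mu>\<close> shows that the integrals of countably many products \<open>c j \<in> \<C>\<close> determine vague convergence.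
  On \<open>M(X)\<close>, the principle with \<open>g j \<mu> = exp (- \<mu>(c j))\<close> turns convergence of Laplace functionals,
  which are the moments of the \<open>g j\<close>, into convergence in distribution.
\<close>

subsection \<open>Convergence of moments on a cube\<close>

text \<open>The polynomials in the coordinates. Multiplication by a single coordinate is taken as a
  constructor, and closure under products is derived from it: in an induction on moments, one
  coordinate factor can then be moved to the front of the index list.\<close>

inductive coordinate_polynomial :: "((nat \<Rightarrow> real) \<Rightarrow> real) \<Rightarrow> bool" where
  const: "coordinate_polynomial (\<lambda>_. c)"
| add: "coordinate_polynomial p \<Longrightarrow> coordinate_polynomial q \<Longrightarrow> coordinate_polynomial (\<lambda>t. p t + q t)"
| coord: "coordinate_polynomial p \<Longrightarrow> coordinate_polynomial (\<lambda>t. t i * p t)"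

lemma coordinate_polynomial_scale:
  "coordinate_polynomial p \<Longrightarrow> coordinate_polynomial (\<lambda>t. c * p t)"
proof (induction rule: coordinate_polynomial.induct)
  case (coord p i)
  then show ?case
    using coordinate_polynomial.coord[OF coord.IH, of i] by (simp add: mult.left_commute)
qed (auto simp: distrib_left intro: coordinate_polynomial.intros)

lemma coordinate_polynomial_mult:
  "coordinate_polynomial p \<Longrightarrow> coordinate_polynomial q \<Longrightarrow> coordinate_polynomial (\<lambda>t. p t * q t)"
proof (induction rule: coordinate_polynomial.induct)
  case (coord p i)
  then show ?case
    using coordinate_polynomial.coord[OF coord.IH, of i] by (simp add: mult.assoc)
qed (auto simp: distrib_right intro: coordinate_polynomial.intros coordinate_polynomial_scale)

lemma continuous_on_coordinate_polynomial:
  "coordinate_polynomial p \<Longrightarrow> continuous_on S p"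
  by (induction rule: coordinate_polynomial.induct)
     (auto intro!: continuous_intros continuous_on_subset[OF continuous_on_product_coordinates])

text \<open>Tychonoff: the topology on sequences is the product topology, and the cube is a product
  of compact intervals.\<close>

lemma compact_cube: "compact {t :: nat \<Rightarrow> real. \<forall>i. \<bar>t i\<bar> \<le> b i}"
proof -
  have "compactin (product_topology (\<lambda>i. euclidean) UNIV) (PiE UNIV (\<lambda>i. {- b i..b i}))"
    by (subst compactin_PiE) auto
  moreover have "PiE UNIV (\<lambda>i. {- b i..b i}) = {t. \<forall>i. \<bar>t i\<bar> \<le> b i}"
    by (auto simp: PiE_def Pi_def abs_le_iff minus_le_iff)
  ultimately show ?thesis
    by (simp add: euclidean_product_topology)
qed

text \<open>Stone-Weierstrass on the compact cube: the coordinate polynomials form an algebra with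
  constants, and the coordinates separate points.\<close>

lemma coordinate_polynomial_approx:
  fixes F :: "(nat \<Rightarrow> real) \<Rightarrow> real"
  assumes "continuous_on UNIV F" "0 < e"
  obtains p where "coordinate_polynomial p"
    "\<And>t. (\<And>i. \<bar>t i\<bar> \<le> b i) \<Longrightarrow> \<bar>F t - p t\<bar> < e"
proof -
  have "\<exists>p. coordinate_polynomial p \<and> (\<forall>t\<in>{t. \<forall>i. \<bar>t i\<bar> \<le> b i}. \<bar>F t - p t\<bar> < e)"
  proof (rule Stone_Weierstrass_HOL[OF compact_cube])
    fix s t :: "nat \<Rightarrow> real"
    assume "s \<in> {t. \<forall>i. \<bar>t i\<bar> \<le> b i} \<and> t \<in> {t. \<forall>i. \<bar>t i\<bar> \<le> b i} \<and> s \<noteq> t"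
    then obtain i where "s i \<noteq> t i" by blast
    then show "\<exists>f. coordinate_polynomial f \<and> f s \<noteq> f t"
      using coordinate_polynomial.coord[OF coordinate_polynomial.const[of 1], of i]
      by (intro exI[of _ "\<lambda>t. t i * 1"]) auto
  qed (use assms in \<open>auto intro: coordinate_polynomial.intros coordinate_polynomial_mult
         continuous_on_coordinate_polynomial continuous_on_subset\<close>)
  then show thesis using that by auto
qed

lemma borel_measurable_prod_list:
  fixes Z :: "'w \<Rightarrow> nat \<Rightarrow> real"
  assumes "\<And>i. (\<lambda>\<omega>. Z \<omega> i) \<in> borel_measurable M"
  shows "(\<lambda>\<omega>. prod_list (map (Z \<omega>) is)) \<in> borel_measurable M"
  using assms by (induction "is") auto

lemma continuous_on_cube_bounded:
  fixes F :: "(nat \<Rightarrow> real) \<Rightarrow> real"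
  assumes "continuous_on UNIV F"
  obtains B where "\<And>t. (\<And>i. \<bar>t i\<bar> \<le> b i) \<Longrightarrow> \<bar>F t\<bar> \<le> B"
proof -
  have "compact (F ` {t. \<forall>i. \<bar>t i\<bar> \<le> b i})"
    by (intro compact_continuous_image compact_cube continuous_on_subset[OF assms]) auto
  then obtain B where "\<forall>x\<in>F ` {t. \<forall>i. \<bar>t i\<bar> \<le> b i}. norm x \<le> B"
    using compact_imp_bounded bounded_iff by metis
  then show thesis using that[of B] by auto
qed

text \<open>\<open>F\<close> is bounded on the cube by compactness and the measure is finite.
  Measurability of \<open>Z\<close> as a map into the sequence space reduces to its coordinates,
  since there are only countably many of them.\<close>

lemma integrable_continuous_cube:
  fixes F :: "(nat \<Rightarrow> real) \<Rightarrow> real"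
  assumes "finite_measure M"
    and "\<And>\<omega> i. \<omega> \<in> space M \<Longrightarrow> \<bar>Z \<omega> i\<bar> \<le> b i"
    and "\<And>i. (\<lambda>\<omega>. Z \<omega> i) \<in> borel_measurable M"
    and F: "continuous_on UNIV F"
  shows "integrable M (\<lambda>\<omega>. F (Z \<omega>))"
proof -
  interpret finite_measure M by fact
  obtain B where B: "\<And>t. (\<And>i. \<bar>t i\<bar> \<le> b i) \<Longrightarrow> \<bar>F t\<bar> \<le> B"
    using continuous_on_cube_bounded[OF F] by blast
  have "Z \<in> borel_measurable M"
    by (rule measurable_coordinatewise_then_product) fact
  then have "(\<lambda>\<omega>. F (Z \<omega>)) \<in> borel_measurable M"
    using borel_measurable_continuous_onI[OF F] by measurable
  then show ?thesis
    by (rule integrable_const_bound[of _ B, rotated]) (use B assms(2) in auto)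
qed

lemma continuous_on_prod_list:
  "continuous_on UNIV (\<lambda>t :: nat \<Rightarrow> real. prod_list (map t is))"
  by (induction "is") (auto intro!: continuous_intros continuous_on_product_coordinates)

text \<open>Integrals of coordinate polynomials are finite linear combinations of moments, hence
  converge. A uniform approximation of \<open>F\<close> on the cube transfers this to
  \<open>F\<close>, because the total masses stay bounded.\<close>

lemma method_of_moments:
  fixes Zs :: "nat \<Rightarrow> 'w \<Rightarrow> nat \<Rightarrow> real" and Z :: "'v \<Rightarrow> nat \<Rightarrow> real"
    and F :: "(nat \<Rightarrow> real) \<Rightarrow> real"
  assumes fin: "\<And>n. finite_measure (Ps n)" "finite_measure P"
    and bnd: "\<And>n \<omega> i. \<omega> \<in> space (Ps n) \<Longrightarrow> \<bar>Zs n \<omega> i\<bar> \<le> b i"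
             "\<And>\<omega> i. \<omega> \<in> space P \<Longrightarrow> \<bar>Z \<omega> i\<bar> \<le> b i"
    and meas: "\<And>n i. (\<lambda>\<omega>. Zs n \<omega> i) \<in> borel_measurable (Ps n)"
              "\<And>i. (\<lambda>\<omega>. Z \<omega> i) \<in> borel_measurable P"
    and mom: "\<And>is. (\<lambda>n. \<integral>\<omega>. prod_list (map (Zs n \<omega>) is) \<partial>Ps n)
                \<longlonglongrightarrow> (\<integral>\<omega>. prod_list (map (Z \<omega>) is) \<partial>P)"
    and F: "continuous_on UNIV F"
  shows "(\<lambda>n. \<integral>\<omega>. F (Zs n \<omega>) \<partial>Ps n) \<longlonglongrightarrow> (\<integral>\<omega>. F (Z \<omega>) \<partial>P)"
proof -
  have ints: "integrable (Ps n) (\<lambda>\<omega>. G (Zs n \<omega>))" if "continuous_on UNIV G" for G :: "(nat \<Rightarrow> real) \<Rightarrow> real" and n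
    by (rule integrable_continuous_cube[where b = b and F = G and Z = "Zs n"]) (use fin bnd meas that in auto)
  have int: "integrable P (\<lambda>\<omega>. G (Z \<omega>))" if "continuous_on UNIV G" for G :: "(nat \<Rightarrow> real) \<Rightarrow> real"
    by (rule integrable_continuous_cube[where b = b and F = G and Z = "Z"]) (use fin bnd meas that in auto)
  \<comment> \<open>The claim carries an arbitrary extra product so that the induction closes: a
    coordinate in front of \<open>p\<close> is absorbed as a new head of \<open>is\<close>.\<close>
  have poly: "(\<lambda>n. \<integral>\<omega>. p (Zs n \<omega>) * prod_list (map (Zs n \<omega>) is) \<partial>Ps n)
                \<longlonglongrightarrow> (\<integral>\<omega>. p (Z \<omega>) * prod_list (map (Z \<omega>) is) \<partial>P)"
    if "coordinate_polynomial p" for p "is"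
    using that
  proof (induction arbitrary: "is" rule: coordinate_polynomial.induct)
    case (const c)
    then show ?case by (auto intro!: tendsto_intros mom)
  next
    case (add p q)
    have *: "continuous_on UNIV (\<lambda>t. r t * prod_list (map t is))" if "coordinate_polynomial r" for r
      by (intro continuous_intros continuous_on_prod_list continuous_on_coordinate_polynomial that)
    show ?case
      unfolding distrib_right
      using tendsto_add[OF add.IH]
      by (simp add: Bochner_Integration.integral_add ints[OF *] int[OF *] add.hyps)
  next
    case (coord p i)
    show ?case using coord.IH[of "i # is"] by (simp add: mult_ac)
  qed
  \<comment> \<open>The empty product is 1, so the moment for the empty list is the total
    mass.\<close>
  have mass: "(\<lambda>n. measure (Ps n) (space (Ps n))) \<longlonglongrightarrow> measure P (space P)"
    using mom[of "[]"] by simp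
  then obtain Q where Q: "\<And>n. measure (Ps n) (space (Ps n)) \<le> Q"
    using convergent_imp_Bseq[THEN BseqD] unfolding convergent_def
    by (metis (no_types, lifting) abs_le_D1 real_norm_def)
  have Q0: "0 \<le> Q" using Q[of 0] measure_nonneg order_trans by blast
  have QP: "measure P (space P) \<le> Q" using Q mass by (intro LIMSEQ_le_const2) auto
  show ?thesis
  proof (rule tendstoI)
    fix e :: real assume "0 < e"
    \<comment> \<open>One third of \<open>e\<close> goes to each of the two approximations by
      \<open>p\<close> and one to the convergence of the integrals of \<open>p\<close>. The summand
      1 guards against \<open>Q = 0\<close>.\<close>
    define d where "d = e / (3 * (Q + 1))"
    have d: "0 < d" "d * Q < e / 3"
      using \<open>0 < e\<close> Q0 by (auto simp: d_def field_simps add_pos_nonneg)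
    obtain p where p: "coordinate_polynomial p"
      and pF: "\<And>t. (\<And>i. \<bar>t i\<bar> \<le> b i) \<Longrightarrow> \<bar>F t - p t\<bar> < d"
      using coordinate_polynomial_approx[OF F d(1)] by blast
    note cp = continuous_on_coordinate_polynomial[OF p]
    have cFp: "continuous_on UNIV (\<lambda>t. F t - p t)"
      by (intro continuous_intros cp F)
    have approx: "\<bar>(\<integral>\<omega>. F (Y \<omega>) \<partial>M) - (\<integral>\<omega>. p (Y \<omega>) \<partial>M)\<bar> < e / 3"
      if M: "finite_measure M" and Y: "\<And>\<omega> i. \<omega> \<in> space M \<Longrightarrow> \<bar>Y \<omega> i\<bar> \<le> b i"
        and YM: "\<And>i. (\<lambda>\<omega>. Y \<omega> i) \<in> borel_measurable M"
        and MQ: "measure M (space M) \<le> Q" for M :: "'z measure" and Y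
    proof -
      interpret finite_measure M by fact
      have i: "integrable M (\<lambda>\<omega>. G (Y \<omega>))" if "continuous_on UNIV G" for G :: "(nat \<Rightarrow> real) \<Rightarrow> real"
        by (rule integrable_continuous_cube[where b = b and F = G and Z = "Y"]) (use M Y YM that in auto)
      have "\<bar>(\<integral>\<omega>. F (Y \<omega>) \<partial>M) - (\<integral>\<omega>. p (Y \<omega>) \<partial>M)\<bar> = \<bar>\<integral>\<omega>. F (Y \<omega>) - p (Y \<omega>) \<partial>M\<bar>"
        by (simp add: Bochner_Integration.integral_diff i F cp)
      also have "\<dots> \<le> (\<integral>\<omega>. \<bar>F (Y \<omega>) - p (Y \<omega>)\<bar> \<partial>M)"
        using integral_abs_bound by blast
      also have "\<dots> \<le> (\<integral>\<omega>. d \<partial>M)"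
        by (intro integral_mono integrable_abs i cFp) (auto intro!: less_imp_le pF Y)
      also have "\<dots> \<le> d * Q"
        using MQ d by (simp add: mult.commute)
      finally show ?thesis using d by simp
    qed
    have "(\<lambda>n. \<integral>\<omega>. p (Zs n \<omega>) \<partial>Ps n) \<longlonglongrightarrow> (\<integral>\<omega>. p (Z \<omega>) \<partial>P)"
      using poly[OF p, of "[]"] by simp
    from tendstoD[OF this, of "e / 3"] \<open>0 < e\<close>
    have "\<forall>\<^sub>F n in sequentially. \<bar>(\<integral>\<omega>. p (Zs n \<omega>) \<partial>Ps n) - (\<integral>\<omega>. p (Z \<omega>) \<partial>P)\<bar> < e / 3"
      by (simp add: dist_real_def)
    then show "\<forall>\<^sub>F n in sequentially. dist (\<integral>\<omega>. F (Zs n \<omega>) \<partial>Ps n) (\<integral>\<omega>. F (Z \<omega>) \<partial>P) < e"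
    proof eventually_elim
      case (elim n)
      have "\<bar>(\<integral>\<omega>. F (Zs n \<omega>) \<partial>Ps n) - (\<integral>\<omega>. p (Zs n \<omega>) \<partial>Ps n)\<bar> < e / 3"
        by (intro approx fin bnd meas Q)
      moreover have "\<bar>(\<integral>\<omega>. F (Z \<omega>) \<partial>P) - (\<integral>\<omega>. p (Z \<omega>) \<partial>P)\<bar> < e / 3"
        by (intro approx fin bnd meas QP)
      ultimately show ?case using elim unfolding dist_real_def by linarith
    qed
  qed
qed

subsection \<open>Functions continuous for the topology induced by a sequence\<close>

text \<open>
  The inf-convolution depends on \<open>x\<close> only through \<open>g 0 x, \<dots>, g (k - 1) x\<close>, continuously, stays
  below \<open>\<phi>\<close>, and converges to \<open>\<phi>\<close> as soon as \<open>\<phi>\<close> is sequentially continuous for the topology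
  induced by the \<open>g i\<close>. This reduces test functions \<open>\<phi>\<close> to continuous functions on a cube.
\<close>

definition inf_convolution ::
    "'b set \<Rightarrow> (nat \<Rightarrow> 'b \<Rightarrow> real) \<Rightarrow> ('b \<Rightarrow> real) \<Rightarrow> nat \<Rightarrow> (nat \<Rightarrow> real) \<Rightarrow> real" where
  "inf_convolution S g \<phi> k t = (INF y\<in>S. \<phi> y + real k * (\<Sum>i<k. \<bar>t i - g i y\<bar>))"

context
  fixes S :: "'b set" and g :: "nat \<Rightarrow> 'b \<Rightarrow> real" and \<phi> :: "'b \<Rightarrow> real"
  assumes S: "S \<noteq> {}" and nonneg: "\<And>x. x \<in> S \<Longrightarrow> 0 \<le> \<phi> x"
begin

lemma inf_convolution_bdd_below:
  "bdd_below ((\<lambda>y. \<phi> y + real k * (\<Sum>i<k. \<bar>t i - g i y\<bar>)) ` S)"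
  by (rule bdd_belowI2[of _ 0]) (auto intro!: add_nonneg_nonneg mult_nonneg_nonneg sum_nonneg nonneg)

lemma inf_convolution_lower:
  "y \<in> S \<Longrightarrow> inf_convolution S g \<phi> k t \<le> \<phi> y + real k * (\<Sum>i<k. \<bar>t i - g i y\<bar>)"
  unfolding inf_convolution_def by (rule cINF_lower[OF inf_convolution_bdd_below])

lemma inf_convolution_nonneg: "0 \<le> inf_convolution S g \<phi> k t"
  unfolding inf_convolution_def
  by (rule cINF_greatest[OF S]) (auto intro!: add_nonneg_nonneg mult_nonneg_nonneg sum_nonneg nonneg)

lemma inf_convolution_le: "x \<in> S \<Longrightarrow> inf_convolution S g \<phi> k (\<lambda>i. g i x) \<le> \<phi> x"
  using inf_convolution_lower[of x k "\<lambda>i. g i x"] by simp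

text \<open>Each function under the infimum is Lipschitz with constant \<open>k\<close> for the sum
  of the first \<open>k\<close> coordinate distances, and an infimum inherits this bound.\<close>

lemma inf_convolution_lipschitz:
  "inf_convolution S g \<phi> k t \<le> inf_convolution S g \<phi> k s + real k * (\<Sum>i<k. \<bar>t i - s i\<bar>)"
proof -
  have "inf_convolution S g \<phi> k t - real k * (\<Sum>i<k. \<bar>t i - s i\<bar>) \<le> inf_convolution S g \<phi> k s"
    unfolding inf_convolution_def[of S g \<phi> k s]
  proof (rule cINF_greatest[OF S])
    fix y assume "y \<in> S"
    have "(\<Sum>i<k. \<bar>t i - g i y\<bar>) \<le> (\<Sum>i<k. \<bar>s i - g i y\<bar>) + (\<Sum>i<k. \<bar>t i - s i\<bar>)"
      unfolding sum.distrib[symmetric] by (rule sum_mono) linarith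
    then have "real k * (\<Sum>i<k. \<bar>t i - g i y\<bar>)
        \<le> real k * (\<Sum>i<k. \<bar>s i - g i y\<bar>) + real k * (\<Sum>i<k. \<bar>t i - s i\<bar>)"
      unfolding distrib_left[symmetric] by (rule mult_left_mono) simp
    then show "inf_convolution S g \<phi> k t - real k * (\<Sum>i<k. \<bar>t i - s i\<bar>)
        \<le> \<phi> y + real k * (\<Sum>i<k. \<bar>s i - g i y\<bar>)"
      using inf_convolution_lower[OF \<open>y \<in> S\<close>, of k t] by linarith
  qed
  then show ?thesis by linarith
qed

text \<open>The Lipschitz bound involves finitely many coordinates only, so it is continuous for the
  product topology and squeezes the increments to 0.\<close>

lemma continuous_on_inf_convolution: "continuous_on UNIV (inf_convolution S g \<phi> k)"
  unfolding continuous_on_def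
proof (intro ballI)
  fix t :: "nat \<Rightarrow> real"
  have "continuous_on UNIV (\<lambda>s. real k * (\<Sum>i<k. \<bar>t i - s i\<bar>))"
    by (intro continuous_intros continuous_on_product_coordinates)
  then have "((\<lambda>s. real k * (\<Sum>i<k. \<bar>t i - s i\<bar>)) \<longlongrightarrow> 0) (at t)"
    by (force simp: continuous_on_def dest: spec[of _ t])
  then have "((\<lambda>s. inf_convolution S g \<phi> k s - inf_convolution S g \<phi> k t) \<longlongrightarrow> 0) (at t)"
  proof (rule Lim_null_comparison[rotated], intro always_eventually allI)
    fix s
    show "norm (inf_convolution S g \<phi> k s - inf_convolution S g \<phi> k t)
        \<le> real k * (\<Sum>i<k. \<bar>t i - s i\<bar>)"
      using inf_convolution_lipschitz[of k s t] inf_convolution_lipschitz[of k t s]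
      by (simp add: abs_le_iff abs_minus_commute)
  qed
  then show "(inf_convolution S g \<phi> k \<longlongrightarrow> inf_convolution S g \<phi> k t) (at t within UNIV)"
    by (simp add: LIM_zero_iff)
qed

text \<open>Near-minimizers \<open>y k\<close> have penalty at most \<open>\<phi> x + 1\<close>,
  since the infimum is at most \<open>\<phi> x\<close>. Dividing by the weight \<open>k\<close>
  forces every coordinate \<open>g i (y k)\<close> to \<open>g i x\<close>; then
  \<open>\<phi> (y k)\<close> tends to \<open>\<phi> x\<close> and bounds the infimum from below up
  to a vanishing error.\<close>

lemma inf_convolution_tendsto:
  assumes x: "x \<in> S"
    and cont: "\<And>y. (\<And>n. y n \<in> S) \<Longrightarrow> (\<And>i. (\<lambda>n. g i (y n)) \<longlonglongrightarrow> g i x) \<Longrightarrow> (\<lambda>n. \<phi> (y n)) \<longlonglongrightarrow> \<phi> x"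
  shows "(\<lambda>k. inf_convolution S g \<phi> k (\<lambda>i. g i x)) \<longlonglongrightarrow> \<phi> x"
proof -
  let ?u = "\<lambda>k. inf_convolution S g \<phi> k (\<lambda>i. g i x)"
  have "\<exists>y\<in>S. \<phi> y + real k * (\<Sum>i<k. \<bar>g i x - g i y\<bar>) < ?u k + 1 / real (Suc k)" for k
  proof (rule ccontr)
    assume "\<not> ?thesis"
    then have "?u k + 1 / real (Suc k) \<le> ?u k"
      unfolding inf_convolution_def[of S g \<phi> k "\<lambda>i. g i x"]
      by (intro cINF_greatest[OF S]) (auto simp: not_less)
    then show False by simp
  qed
  then obtain y where yS: "\<And>k. y k \<in> S"
    and y: "\<And>k. \<phi> (y k) + real k * (\<Sum>i<k. \<bar>g i x - g i (y k)\<bar>) < ?u k + 1 / real (Suc k)"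
    by metis
  have "(\<lambda>k. \<phi> (y k)) \<longlonglongrightarrow> \<phi> x"
  proof (rule cont[OF yS])
    fix i
    have "(\<lambda>k. (\<phi> x + 1) / real k) \<longlonglongrightarrow> 0"
      by (rule lim_const_over_n)
    then have "(\<lambda>k. g i (y k) - g i x) \<longlonglongrightarrow> 0"
    proof (rule Lim_null_comparison[rotated])
      \<comment> \<open>The distance in coordinate \<open>i\<close> is a term of the penalty only
        once \<open>k > i\<close>, so the bound is merely eventual.\<close>
      show "\<forall>\<^sub>F k in sequentially. norm (g i (y k) - g i x) \<le> (\<phi> x + 1) / real k"
      proof (rule eventually_mono[OF eventually_gt_at_top[of i]])
        fix k assume "i < k"
        have "\<bar>g i x - g i (y k)\<bar> \<le> (\<Sum>i<k. \<bar>g i x - g i (y k)\<bar>)"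
          using \<open>i < k\<close> by (intro member_le_sum) auto
        then have "real k * \<bar>g i x - g i (y k)\<bar> \<le> real k * (\<Sum>i<k. \<bar>g i x - g i (y k)\<bar>)"
          by (rule mult_left_mono) simp
        also have "\<dots> \<le> ?u k + 1 / real (Suc k)"
          using y[of k] nonneg[OF yS[of k]] by linarith
        also have "\<dots> \<le> \<phi> x + 1"
          using inf_convolution_le[OF x, of k] by (intro add_mono) auto
        finally show "norm (g i (y k) - g i x) \<le> (\<phi> x + 1) / real k"
          using \<open>i < k\<close> by (simp add: field_simps abs_minus_commute)
      qed
    qed
    then show "(\<lambda>k. g i (y k)) \<longlonglongrightarrow> g i x" by (simp add: LIM_zero_iff)
  qed
  then have low: "(\<lambda>k. \<phi> (y k) - 1 / real (Suc k)) \<longlonglongrightarrow> \<phi> x"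
    using tendsto_diff[OF _ LIMSEQ_Suc[OF lim_1_over_n]] by fastforce
  have "\<phi> (y k) - 1 / real (Suc k) \<le> ?u k" for k
  proof -
    have "0 \<le> real k * (\<Sum>i<k. \<bar>g i x - g i (y k)\<bar>)"
      by (intro mult_nonneg_nonneg sum_nonneg) auto
    then show ?thesis using y[of k] by linarith
  qed
  then show ?thesis
    by (intro tendsto_sandwich[OF _ _ low tendsto_const]) (auto intro!: always_eventually inf_convolution_le x)
qed

end

text \<open>\<open>\<phi>\<close> along \<open>X\<close> is the pointwise limit of continuous
  functions of the measurable sequence \<open>g i (X \<omega>)\<close>. Measurability of a test
  function is thus derived from that of the coordinates alone.\<close>

lemma borel_measurable_seq_continuous:
  fixes g :: "nat \<Rightarrow> 'b \<Rightarrow> real" and \<phi> :: "'b \<Rightarrow> real"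
  assumes "\<And>x. x \<in> S \<Longrightarrow> 0 \<le> \<phi> x"
    and cont: "\<And>x y. x \<in> S \<Longrightarrow> (\<And>n. y n \<in> S) \<Longrightarrow> (\<And>i. (\<lambda>n. g i (y n)) \<longlonglongrightarrow> g i x)
                 \<Longrightarrow> (\<lambda>n. \<phi> (y n)) \<longlonglongrightarrow> \<phi> x"
    and X: "\<And>\<omega>. \<omega> \<in> space M \<Longrightarrow> X \<omega> \<in> S"
    and meas: "\<And>i. (\<lambda>\<omega>. g i (X \<omega>)) \<in> borel_measurable M"
  shows "(\<lambda>\<omega>. \<phi> (X \<omega>)) \<in> borel_measurable M"
proof (cases "S = {}")
  case True
  then have "space M = {}" using X by auto
  then show ?thesis by (simp add: measurable_def)
next
  case False
  show ?thesis
  proof (rule borel_measurable_LIMSEQ_real)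
    fix \<omega> assume "\<omega> \<in> space M"
    then show "(\<lambda>k. inf_convolution S g \<phi> k (\<lambda>i. g i (X \<omega>))) \<longlonglongrightarrow> \<phi> (X \<omega>)"
      using assms False by (intro inf_convolution_tendsto) auto
  next
    fix k
    have "(\<lambda>\<omega> i. g i (X \<omega>)) \<in> borel_measurable M"
      by (rule measurable_coordinatewise_then_product) fact
    moreover have "inf_convolution S g \<phi> k \<in> borel_measurable borel"
      using assms False by (intro borel_measurable_continuous_onI continuous_on_inf_convolution) auto
    ultimately show "(\<lambda>\<omega>. inf_convolution S g \<phi> k (\<lambda>i. g i (X \<omega>))) \<in> borel_measurable M"
      by (rule measurable_compose)
  qed
qed

section \<open>From convergence of moments to convergence of integrals of sequentially continuous
  functions\<close>

context
  fixes S :: "'b set" and g :: "nat \<Rightarrow> 'b \<Rightarrow> real" and b :: "nat \<Rightarrow> real"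
    and Ps :: "nat \<Rightarrow> 'w measure" and Xs :: "nat \<Rightarrow> 'w \<Rightarrow> 'b"
    and P :: "'v measure" and X :: "'v \<Rightarrow> 'b"
  assumes S: "S \<noteq> {}"
    and fin: "\<And>n. finite_measure (Ps n)" "finite_measure P"
    and XS: "\<And>n \<omega>. \<omega> \<in> space (Ps n) \<Longrightarrow> Xs n \<omega> \<in> S" "\<And>\<omega>. \<omega> \<in> space P \<Longrightarrow> X \<omega> \<in> S"
    and bnd: "\<And>i x. x \<in> S \<Longrightarrow> \<bar>g i x\<bar> \<le> b i"
    and meas: "\<And>n i. (\<lambda>\<omega>. g i (Xs n \<omega>)) \<in> borel_measurable (Ps n)"
              "\<And>i. (\<lambda>\<omega>. g i (X \<omega>)) \<in> borel_measurable P"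
    and mom: "\<And>is. (\<lambda>n. \<integral>\<omega>. prod_list (map (\<lambda>i. g i (Xs n \<omega>)) is) \<partial>Ps n)
                \<longlonglongrightarrow> (\<integral>\<omega>. prod_list (map (\<lambda>i. g i (X \<omega>)) is) \<partial>P)"
begin

text \<open>The liminf inequality. By dominated convergence some \<open>?F k\<close> already has an
  integral above \<open>a\<close> in the limit; the method of moments carries this to large
  \<open>n\<close>, and \<open>?F k\<close> lies below \<open>\<phi>\<close> on
  \<open>S\<close>.\<close>

lemma eventually_integral_gt:
  fixes \<phi> :: "'b \<Rightarrow> real"
  assumes \<phi>: "\<And>x. x \<in> S \<Longrightarrow> 0 \<le> \<phi> x" "\<And>x. x \<in> S \<Longrightarrow> \<phi> x \<le> c"
    and cont: "\<And>x y. x \<in> S \<Longrightarrow> (\<And>n. y n \<in> S) \<Longrightarrow> (\<And>i. (\<lambda>n. g i (y n)) \<longlonglongrightarrow> g i x)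
                 \<Longrightarrow> (\<lambda>n. \<phi> (y n)) \<longlonglongrightarrow> \<phi> x"
    and "a < (\<integral>\<omega>. \<phi> (X \<omega>) \<partial>P)"
  shows "\<forall>\<^sub>F n in sequentially. a < (\<integral>\<omega>. \<phi> (Xs n \<omega>) \<partial>Ps n)"
proof -
  interpret P: finite_measure P by fact
  let ?F = "inf_convolution S g \<phi>"
  have F: "continuous_on UNIV (?F k)" for k
    by (rule continuous_on_inf_convolution[OF S \<phi>(1)])
  have m: "(\<lambda>\<omega>. \<phi> (X \<omega>)) \<in> borel_measurable P"
    by (rule borel_measurable_seq_continuous[OF \<phi>(1) cont XS(2) meas(2)])
  have intF: "integrable P (\<lambda>\<omega>. ?F k (\<lambda>i. g i (X \<omega>)))" for k
    by (rule integrable_continuous_cube[where b = b and F = "?F k" and Z = "\<lambda>\<omega> i. g i (X \<omega>)"])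
       (use fin meas XS bnd F in auto)
  have "(\<lambda>k. \<integral>\<omega>. ?F k (\<lambda>i. g i (X \<omega>)) \<partial>P) \<longlonglongrightarrow> (\<integral>\<omega>. \<phi> (X \<omega>) \<partial>P)"
  proof (rule integral_dominated_convergence[where w = "\<lambda>_. c"])
    show "AE \<omega> in P. (\<lambda>k. ?F k (\<lambda>i. g i (X \<omega>))) \<longlonglongrightarrow> \<phi> (X \<omega>)"
      using XS \<phi> cont S by (intro AE_I2 inf_convolution_tendsto) auto
    show "AE \<omega> in P. norm (?F k (\<lambda>i. g i (X \<omega>))) \<le> c" for k
    proof (rule AE_I2)
      fix \<omega> assume "\<omega> \<in> space P"
      then have "X \<omega> \<in> S" by (rule XS)
      then have "?F k (\<lambda>i. g i (X \<omega>)) \<le> c"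
        using inf_convolution_le[OF S \<phi>(1)] \<phi>(2) by (meson order_trans)
      then show "norm (?F k (\<lambda>i. g i (X \<omega>))) \<le> c"
        using inf_convolution_nonneg[OF S \<phi>(1), where g = g and k = k and t = "\<lambda>i. g i (X \<omega>)"] by simp
    qed
  qed (use m intF in auto)
  from order_tendstoD(1)[OF this assms(4)] obtain k where k: "a < (\<integral>\<omega>. ?F k (\<lambda>i. g i (X \<omega>)) \<partial>P)"
    by (auto simp: eventually_sequentially)
  have "(\<lambda>n. \<integral>\<omega>. ?F k (\<lambda>i. g i (Xs n \<omega>)) \<partial>Ps n) \<longlonglongrightarrow> (\<integral>\<omega>. ?F k (\<lambda>i. g i (X \<omega>)) \<partial>P)"
    by (rule method_of_moments[where b = b and F = "?F k" and Zs = "\<lambda>n \<omega> i. g i (Xs n \<omega>)"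
          and Z = "\<lambda>\<omega> i. g i (X \<omega>)"])
       (use fin meas XS bnd F mom in auto)
  from order_tendstoD(1)[OF this k] show ?thesis
  proof eventually_elim
    case (elim n)
    interpret finite_measure "Ps n" by (rule fin)
    note elim
    also have "(\<integral>\<omega>. ?F k (\<lambda>i. g i (Xs n \<omega>)) \<partial>Ps n) \<le> (\<integral>\<omega>. \<phi> (Xs n \<omega>) \<partial>Ps n)"
    proof (rule integral_mono)
      show "integrable (Ps n) (\<lambda>\<omega>. ?F k (\<lambda>i. g i (Xs n \<omega>)))"
        by (rule integrable_continuous_cube[where b = b and F = "?F k" and Z = "\<lambda>\<omega> i. g i (Xs n \<omega>)"])
           (use fin meas XS bnd F in auto)
      have "(\<lambda>\<omega>. \<phi> (Xs n \<omega>)) \<in> borel_measurable (Ps n)"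
        by (rule borel_measurable_seq_continuous[OF \<phi>(1) cont XS(1) meas(1)])
      then show "integrable (Ps n) (\<lambda>\<omega>. \<phi> (Xs n \<omega>))"
        by (rule integrable_const_bound[of _ c, rotated]) (use \<phi> XS in auto)
    qed (auto intro!: inf_convolution_le[OF S \<phi>(1)] XS)
    finally show ?case .
  qed
qed

text \<open>The liminf inequality for the nonnegative functions \<open>\<phi> x + c\<close> and
  \<open>c - \<phi> x\<close> gives the two one-sided bounds. The measures need not be
  probabilities, so the masses added by \<open>c\<close> are removed using their own
  convergence.\<close>

lemma moments_imp_integral_tendsto:
  fixes \<phi> :: "'b \<Rightarrow> real"
  assumes \<phi>: "\<And>x. x \<in> S \<Longrightarrow> \<bar>\<phi> x\<bar> \<le> c"
    and cont: "\<And>x y. x \<in> S \<Longrightarrow> (\<And>n. y n \<in> S) \<Longrightarrow> (\<And>i. (\<lambda>n. g i (y n)) \<longlonglongrightarrow> g i x)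
                 \<Longrightarrow> (\<lambda>n. \<phi> (y n)) \<longlonglongrightarrow> \<phi> x"
  shows "(\<lambda>n. \<integral>\<omega>. \<phi> (Xs n \<omega>) \<partial>Ps n) \<longlonglongrightarrow> (\<integral>\<omega>. \<phi> (X \<omega>) \<partial>P)"
proof -
  have b1: "x \<in> S \<Longrightarrow> 0 \<le> \<phi> x + c" "x \<in> S \<Longrightarrow> \<phi> x + c \<le> 2 * c" 
       "x \<in> S \<Longrightarrow> 0 \<le> c - \<phi> x" "x \<in> S \<Longrightarrow> c - \<phi> x \<le> 2 * c" for x
    using \<phi>[of x] by (auto simp: abs_le_iff)
  have c1: "(\<lambda>n. \<phi> (y n) + c) \<longlonglongrightarrow> \<phi> x + c" "(\<lambda>n. c - \<phi> (y n)) \<longlonglongrightarrow> c - \<phi> x"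
    if "x \<in> S" "\<And>n. y n \<in> S" "\<And>i. (\<lambda>n. g i (y n)) \<longlonglongrightarrow> g i x" for x y
    using cont[OF that] by (auto intro!: tendsto_intros)
  have int: "integrable M (\<lambda>\<omega>. \<phi> (Y \<omega>))"
    if "finite_measure M" "\<And>\<omega>. \<omega> \<in> space M \<Longrightarrow> Y \<omega> \<in> S"
      "\<And>i. (\<lambda>\<omega>. g i (Y \<omega>)) \<in> borel_measurable M" for M :: "'z measure" and Y
  proof -
    interpret finite_measure M by fact
    \<comment> \<open>The shift by \<open>c\<close> supplies the nonnegativity on which the
      inf-convolution rests.\<close>
    have "(\<lambda>\<omega>. \<phi> (Y \<omega>) + c) \<in> borel_measurable M"
      by (rule borel_measurable_seq_continuous[where S = S and g = g and \<phi> = "\<lambda>x. \<phi> x + c"])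
         (use b1 c1 that in auto)
    from borel_measurable_diff[OF this borel_measurable_const[of c]]
    have "(\<lambda>\<omega>. \<phi> (Y \<omega>)) \<in> borel_measurable M" by simp
    then show ?thesis
      by (rule integrable_const_bound[of _ c, rotated]) (use \<phi> that in auto)
  qed
  have mass: "(\<lambda>n. measure (Ps n) (space (Ps n))) \<longlonglongrightarrow> measure P (space P)"
    using mom[of "[]"] by simp
  have lsc: "\<forall>\<^sub>F n in sequentially. a < (\<integral>\<omega>. \<phi> (Xs n \<omega>) \<partial>Ps n) + c * measure (Ps n) (space (Ps n))"
    if "a < (\<integral>\<omega>. \<phi> (X \<omega>) \<partial>P) + c * measure P (space P)" for a
  proof -
    interpret P: finite_measure P by fact
    have s: "(\<integral>\<omega>. \<phi> (Xs n \<omega>) + c \<partial>Ps n) = (\<integral>\<omega>. \<phi> (Xs n \<omega>) \<partial>Ps n) + c * measure (Ps n) (space (Ps n))" for n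
    proof -
      interpret finite_measure "Ps n" by (rule fin)
      show ?thesis by (subst Bochner_Integration.integral_add) (auto intro!: int fin XS meas)
    qed
    show ?thesis
      unfolding s[symmetric]
      by (rule eventually_integral_gt[where c = "2 * c" and \<phi> = "\<lambda>x. \<phi> x + c"])
         (use that b1 c1 int[OF fin(2) XS(2) meas(2)] in \<open>auto simp: mult.commute\<close>)
  qed
  have usc: "\<forall>\<^sub>F n in sequentially. a < c * measure (Ps n) (space (Ps n)) - (\<integral>\<omega>. \<phi> (Xs n \<omega>) \<partial>Ps n)"
    if "a < c * measure P (space P) - (\<integral>\<omega>. \<phi> (X \<omega>) \<partial>P)" for a
  proof -
    interpret P: finite_measure P by fact
    have s: "(\<integral>\<omega>. c - \<phi> (Xs n \<omega>) \<partial>Ps n) = c * measure (Ps n) (space (Ps n)) - (\<integral>\<omega>. \<phi> (Xs n \<omega>) \<partial>Ps n)" for n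
    proof -
      interpret finite_measure "Ps n" by (rule fin)
      show ?thesis by (subst Bochner_Integration.integral_diff) (auto intro!: int fin XS meas)
    qed
    show ?thesis
      unfolding s[symmetric]
      by (rule eventually_integral_gt[where c = "2 * c" and \<phi> = "\<lambda>x. c - \<phi> x"])
         (use that b1 c1 int[OF fin(2) XS(2) meas(2)] in \<open>auto simp: mult.commute\<close>)
  qed
  show ?thesis
  proof (rule tendstoI)
    fix e :: real assume "0 < e"
    let ?m = "\<lambda>n. c * measure (Ps n) (space (Ps n))" and ?l = "c * measure P (space P)"
    have "?m \<longlonglongrightarrow> ?l" by (intro tendsto_intros mass)
    from tendstoD[OF this, of "e / 2"] \<open>0 < e\<close>
    have 1: "\<forall>\<^sub>F n in sequentially. \<bar>?m n - ?l\<bar> < e / 2" by (simp add: dist_real_def)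
    have 2: "\<forall>\<^sub>F n in sequentially. (\<integral>\<omega>. \<phi> (X \<omega>) \<partial>P) + ?l - e / 2 < (\<integral>\<omega>. \<phi> (Xs n \<omega>) \<partial>Ps n) + ?m n"
      by (rule lsc) (use \<open>0 < e\<close> in simp)
    have 3: "\<forall>\<^sub>F n in sequentially. ?l - (\<integral>\<omega>. \<phi> (X \<omega>) \<partial>P) - e / 2 < ?m n - (\<integral>\<omega>. \<phi> (Xs n \<omega>) \<partial>Ps n)"
      by (rule usc) (use \<open>0 < e\<close> in simp)
    show "\<forall>\<^sub>F n in sequentially. dist (\<integral>\<omega>. \<phi> (Xs n \<omega>) \<partial>Ps n) (\<integral>\<omega>. \<phi> (X \<omega>) \<partial>P) < e"
      using 1 2 3 unfolding dist_real_def by eventually_elim linarith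
  qed
qed

end

subsection \<open>Countable generating families\<close>

text \<open>Induction on the generation of \<open>W\<close> from the subbase. The conclusion covers
  all limits \<open>z\<close> in a neighbourhood \<open>V\<close>, not only \<open>x\<close>: the
  requirement on \<open>F\<close> then depends on the pair \<open>V\<close>, \<open>W\<close> and on
  no point, which allows a countable selection.\<close>

lemma generate_topology_finite_subfamily:
  fixes C :: "('a::topological_space \<Rightarrow> real) set"
  assumes gen: "(open :: 'a set \<Rightarrow> bool) =
           generate_topology {f -` U | f U. f \<in> C \<and> openin (top_of_set {0..}) U}"
    and nonneg: "\<forall>f\<in>C. \<forall>x. 0 \<le> f x" and "open W" "x \<in> W"
  shows "\<exists>F V. finite F \<and> F \<subseteq> C \<and> open V \<and> x \<in> V \<and>
           (\<forall>z\<in>V. \<forall>y. (\<forall>f\<in>F. (\<lambda>n. f (y n)) \<longlonglongrightarrow> f z) \<longrightarrow> (\<forall>\<^sub>F n in sequentially. y n \<in> W))"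
proof -
  have "generate_topology {f -` U | f U. f \<in> C \<and> openin (top_of_set {0..}) U} W"
    using \<open>open W\<close> unfolding gen .
  then show ?thesis
    using \<open>x \<in> W\<close>
  proof (induction arbitrary: x rule: generate_topology.induct)
    case UNIV
    show ?case by (rule exI[of _ "{}"], rule exI[of _ UNIV]) auto
  next
    case (Int A B)
    from Int.IH(1)[of x] Int.prems obtain F V where F: "finite F" "F \<subseteq> C" "open V" "x \<in> V"
      "\<And>z y. z \<in> V \<Longrightarrow> (\<forall>f\<in>F. (\<lambda>n. f (y n)) \<longlonglongrightarrow> f z) \<Longrightarrow> (\<forall>\<^sub>F n in sequentially. y n \<in> A)"
      by (auto 4 0)
    from Int.IH(2)[of x] Int.prems obtain F' V' where F': "finite F'" "F' \<subseteq> C" "open V'" "x \<in> V'"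
      "\<And>z y. z \<in> V' \<Longrightarrow> (\<forall>f\<in>F'. (\<lambda>n. f (y n)) \<longlonglongrightarrow> f z) \<Longrightarrow> (\<forall>\<^sub>F n in sequentially. y n \<in> B)"
      by (auto 4 0)
    show ?case
      by (rule exI[of _ "F \<union> F'"], rule exI[of _ "V \<inter> V'"])
         (use F F' in \<open>auto simp: eventually_conj_iff\<close>)
  next
    case (UN K)
    then obtain A where A: "A \<in> K" "x \<in> A" by auto
    from UN.IH[OF this] obtain F V where F: "finite F" "F \<subseteq> C" "open V" "x \<in> V"
      "\<And>z y. z \<in> V \<Longrightarrow> (\<forall>f\<in>F. (\<lambda>n. f (y n)) \<longlonglongrightarrow> f z) \<Longrightarrow> (\<forall>\<^sub>F n in sequentially. y n \<in> A)"
      by (auto 4 0)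
    have "\<forall>\<^sub>F n in sequentially. y n \<in> \<Union>K" if "z \<in> V" "\<forall>f\<in>F. (\<lambda>n. f (y n)) \<longlonglongrightarrow> f z" for z y
      using F(5)[OF that] by (rule eventually_mono) (use A in auto)
    then show ?case using F by blast
  next
    case (Basis W)
    then obtain f U where f: "f \<in> C" "openin (top_of_set {0..}) U" "W = f -` U" by auto
    \<comment> \<open>\<open>U\<close> is open only relative to the half-line; nonnegativity of
      \<open>f\<close> turns membership of \<open>f (y n)\<close> in \<open>T\<close> into
      membership in \<open>U\<close>.\<close>
    then obtain T where T: "open T" "U = {0..} \<inter> T" by (auto simp: openin_open)
    have "\<forall>\<^sub>F n in sequentially. y n \<in> W" if "z \<in> W" "(\<lambda>n. f (y n)) \<longlonglongrightarrow> f z" for z y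
    proof -
      have "\<forall>\<^sub>F n in sequentially. f (y n) \<in> T"
        by (rule topological_tendstoD[OF that(2) T(1)]) (use that f T in auto)
      then show ?thesis by (rule eventually_mono) (use f T nonneg in auto)
    qed
    moreover have "open W" unfolding gen by (rule generate_topology.Basis) (use f in auto)
    ultimately show ?case
      by (intro exI[of _ "{f}"] exI[of _ W]) (use f Basis.prems in auto)
  qed
qed

text \<open>For each pair of sets of a countable basis one finite subfamily is selected, if a
  suitable one exists. The union of these choices is countable and detects convergence.\<close>

lemma countable_generating_subfamily:
  fixes C :: "('a::second_countable_topology \<Rightarrow> real) set"
  assumes gen: "(open :: 'a set \<Rightarrow> bool) =
           generate_topology {f -` U | f U. f \<in> C \<and> openin (top_of_set {0..}) U}"
    and nonneg: "\<And>f x. f \<in> C \<Longrightarrow> 0 \<le> f x"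
  obtains G where "countable G" "G \<subseteq> C"
    "\<And>x y. (\<And>f. f \<in> G \<Longrightarrow> (\<lambda>n. f (y n)) \<longlonglongrightarrow> f x) \<Longrightarrow> y \<longlonglongrightarrow> x"
proof -
  obtain B :: "'a set set" where B: "countable B" "topological_basis B"
    using ex_countable_basis by blast
  \<comment> \<open>\<open>Q\<close> survives shrinking \<open>V\<close>, so the neighbourhood of
    \<open>x\<close> may be replaced by a basic one.\<close>
  define Q where "Q F V W \<longleftrightarrow> finite F \<and> F \<subseteq> C \<and>
      (\<forall>z\<in>V. \<forall>y. (\<forall>f\<in>F. (\<lambda>n. f (y n)) \<longlonglongrightarrow> f z) \<longrightarrow> (\<forall>\<^sub>F n in sequentially. y n \<in> W))"
    for F and V W :: "'a set"
  \<comment> \<open>The default \<open>{}\<close> for pairs without a suitable \<open>F\<close>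
    keeps every selected family finite and inside \<open>C\<close>.\<close>
  have "\<exists>F. finite F \<and> F \<subseteq> C \<and> ((\<exists>F. Q F V W) \<longrightarrow> Q F V W)" for V W
  proof (cases "\<exists>F. Q F V W")
    case True
    then obtain F where "Q F V W" ..
    then show ?thesis by (intro exI[of _ F]) (simp add: Q_def)
  next
    case False
    then show ?thesis by (intro exI[of _ "{}"]) blast
  qed
  then obtain H where H: "\<And>V W. finite (H V W)" "\<And>V W. H V W \<subseteq> C"
    and Q: "\<And>V W. \<exists>F. Q F V W \<Longrightarrow> Q (H V W) V W"
    by metis
  show thesis
  proof (rule that)
    show "countable (\<Union>V\<in>B. \<Union>W\<in>B. H V W)"
      by (intro countable_UN B(1) countable_finite[OF H(1)])
    show "(\<Union>V\<in>B. \<Union>W\<in>B. H V W) \<subseteq> C" by (intro UN_least H(2))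
    fix x y assume lim: "\<And>f. f \<in> (\<Union>V\<in>B. \<Union>W\<in>B. H V W) \<Longrightarrow> (\<lambda>n. f (y n)) \<longlonglongrightarrow> f x"
    show "y \<longlonglongrightarrow> x"
    proof (rule topological_tendstoI)
      fix A assume "open A" "x \<in> A"
      then obtain W where W: "W \<in> B" "x \<in> W" "W \<subseteq> A"
        using B topological_basisE by metis
      then have "open W" using B topological_basis_open by blast
      from generate_topology_finite_subfamily[OF gen _ this W(2)]
      obtain F V where F: "Q F V W" "open V" "x \<in> V"
        unfolding Q_def using nonneg by auto
      from F(2,3) obtain V' where V': "V' \<in> B" "x \<in> V'" "V' \<subseteq> V"
        using B topological_basisE by metis
      then have "Q F V' W" using F by (auto simp: Q_def)
      then have "Q (H V' W) V' W" using Q by blast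
      then have "\<forall>\<^sub>F n in sequentially. y n \<in> W"
        unfolding Q_def using V' W lim by blast
      then show "\<forall>\<^sub>F n in sequentially. y n \<in> A"
        by (rule eventually_mono) (use W in auto)
    qed
  qed
qed

subsection \<open>Locally finite measures and the vague topology\<close>

lemma sets_locally_finite: "\<mu> \<in> locally_finite_measures Bb \<Longrightarrow> sets \<mu> = sets borel"
  by (simp add: locally_finite_measures_def)

lemma CB_plus_measurable: "f \<in> CB_plus Bb \<Longrightarrow> f \<in> borel_measurable borel"
  by (auto simp: CB_plus_def intro: borel_measurable_continuous_onI)

lemma CB_plus_nonneg: "f \<in> CB_plus Bb \<Longrightarrow> 0 \<le> f x"
  by (simp add: CB_plus_def)

lemma CB_plus_bound: "f \<in> CB_plus Bb \<Longrightarrow> \<exists>B. \<forall>x. \<bar>f x\<bar> \<le> B"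
  by (force simp: CB_plus_def bounded_iff)

text \<open>\<open>f\<close> is dominated by a constant on its closed support, which is bounded and
  so has finite mass.\<close>

lemma CB_plus_integrable:
  assumes \<mu>: "\<mu> \<in> locally_finite_measures Bb" and f: "f \<in> CB_plus Bb"
  shows "integrable \<mu> f"
proof -
  let ?D = "closure {x. f x \<noteq> 0}"
  obtain B where B: "\<And>x. \<bar>f x\<bar> \<le> B" using CB_plus_bound[OF f] by blast
  have [measurable]: "f \<in> borel_measurable \<mu>" "?D \<in> sets \<mu>"
    using CB_plus_measurable[OF f] sets_locally_finite[OF \<mu>]
    by (auto simp: measurable_cong_sets[OF sets_locally_finite[OF \<mu>] refl])
  have "emeasure \<mu> ?D < \<infinity>"
    using \<mu> f by (auto simp: locally_finite_measures_def CB_plus_def)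
  then have "integrable \<mu> (\<lambda>x. B * indicator ?D x)" by simp
  then show ?thesis
  proof (rule Bochner_Integration.integrable_bound)
    show "AE x in \<mu>. norm (f x) \<le> norm (B * indicator ?D x :: real)"
    proof (rule AE_I2)
      fix x
      show "norm (f x) \<le> norm (B * indicator ?D x :: real)"
        using B[of x] subsetD[OF closure_subset, of x "{x. f x \<noteq> 0}"] by (cases "f x = 0") auto
    qed
  qed simp
qed

section \<open>Measurability of integrals as functions of the measure\<close>

lemma space_locally_finite_algebra:
  "Bb \<noteq> {} \<Longrightarrow> space (locally_finite_algebra Bb) = locally_finite_measures Bb"
  by (auto simp: locally_finite_algebra_def space_Sup_eq_UN)

lemma measurable_emeasure_locally_finite:
  "B \<in> Bb \<Longrightarrow> (\<lambda>\<mu>. emeasure \<mu> B) \<in> borel_measurable (locally_finite_algebra Bb)"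
  unfolding locally_finite_algebra_def
  by (rule measurable_SUP1) (auto intro: measurable_vimage_algebra1)

text \<open>Standard induction on \<open>u\<close>. The factor \<open>indicator D\<close> keeps the
  base case within bounded sets: \<open>A \<inter> D\<close> lies in \<open>Bb\<close>, where
  evaluation is measurable by construction.\<close>

lemma measurable_nn_integral_locally_finite:
  assumes Bb: "boundedness Bb" and D: "D \<in> Bb" and u: "u \<in> borel_measurable borel"
  shows "(\<lambda>\<mu>. \<integral>\<^sup>+x. u x * indicator D x \<partial>\<mu>) \<in> borel_measurable (locally_finite_algebra Bb)"
    (is "_ \<in> ?B")
proof -
  have sp: "space (locally_finite_algebra Bb) = locally_finite_measures Bb"
    using D by (intro space_locally_finite_algebra) auto
  have D': "D \<in> sets borel" using Bb D by (auto simp: boundedness_def)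
  have m: "v \<in> borel_measurable \<mu>" 
    if "\<mu> \<in> space (locally_finite_algebra Bb)" "v \<in> borel_measurable borel" for \<mu> and v :: "'a \<Rightarrow> ennreal"
    using that by (simp add: sp measurable_cong_sets[OF sets_locally_finite refl])
  have mD: "D \<in> sets \<mu>" if "\<mu> \<in> space (locally_finite_algebra Bb)" for \<mu>
    using that D' by (simp add: sp sets_locally_finite)
  show ?thesis
    using u
  proof (induction rule: borel_measurable_induct)
    case (cong f g)
    then show ?case by (simp add: space_borel cong: nn_integral_cong)
  next
    case (set A)
    have "(\<lambda>\<mu>. \<integral>\<^sup>+x. indicator A x * indicator D x \<partial>\<mu>) \<in> ?B \<longleftrightarrow> (\<lambda>\<mu>. emeasure \<mu> (A \<inter> D)) \<in> ?B"
    proof (rule measurable_cong)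
      fix \<mu> assume "\<mu> \<in> space (locally_finite_algebra Bb)"
      then have "A \<inter> D \<in> sets \<mu>" using set D' by (auto simp: sp sets_locally_finite)
      then show "(\<integral>\<^sup>+x. indicator A x * indicator D x \<partial>\<mu>) = emeasure \<mu> (A \<inter> D)"
        by (simp add: indicator_inter_arith[symmetric])
    qed
    moreover have "A \<inter> D \<in> Bb"
      using Bb D D' set unfolding boundedness_def by (metis Int_lower2 sets.Int)
    ultimately show ?case using measurable_emeasure_locally_finite by blast
  next
    case (mult u c)
    have "(\<lambda>\<mu>. \<integral>\<^sup>+x. c * u x * indicator D x \<partial>\<mu>) \<in> ?B \<longleftrightarrow>
        (\<lambda>\<mu>. c * (\<integral>\<^sup>+x. u x * indicator D x \<partial>\<mu>)) \<in> ?B"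
    proof (rule measurable_cong)
      fix \<mu> assume \<mu>: "\<mu> \<in> space (locally_finite_algebra Bb)"
      have [measurable]: "u \<in> borel_measurable \<mu>" "D \<in> sets \<mu>"
        by (rule m[OF \<mu> \<open>u \<in> borel_measurable borel\<close>], rule mD[OF \<mu>])
      show "(\<integral>\<^sup>+x. c * u x * indicator D x \<partial>\<mu>) = c * (\<integral>\<^sup>+x. u x * indicator D x \<partial>\<mu>)"
        unfolding mult.assoc by (rule nn_integral_cmult) measurable
    qed
    then show ?case using mult.IH by simp
  next
    case (add u v)
    have "(\<lambda>\<mu>. \<integral>\<^sup>+x. (v x + u x) * indicator D x \<partial>\<mu>) \<in> ?B \<longleftrightarrow>
        (\<lambda>\<mu>. (\<integral>\<^sup>+x. v x * indicator D x \<partial>\<mu>) + (\<integral>\<^sup>+x. u x * indicator D x \<partial>\<mu>)) \<in> ?B"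
    proof (rule measurable_cong)
      fix \<mu> assume \<mu>: "\<mu> \<in> space (locally_finite_algebra Bb)"
      have [measurable]: "u \<in> borel_measurable \<mu>" "v \<in> borel_measurable \<mu>" "D \<in> sets \<mu>"
        by (rule m[OF \<mu> \<open>u \<in> borel_measurable borel\<close>], rule m[OF \<mu> \<open>v \<in> borel_measurable borel\<close>], rule mD[OF \<mu>])
      show "(\<integral>\<^sup>+x. (v x + u x) * indicator D x \<partial>\<mu>) =
          (\<integral>\<^sup>+x. v x * indicator D x \<partial>\<mu>) + (\<integral>\<^sup>+x. u x * indicator D x \<partial>\<mu>)"
        unfolding distrib_right by (rule nn_integral_add) measurable
    qed
    then show ?case using add.IH by simp
  next
    case (seq U)
    have "(\<lambda>\<mu>. \<integral>\<^sup>+x. (SUP i. U i) x * indicator D x \<partial>\<mu>) \<in> ?B \<longleftrightarrow>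
        (\<lambda>\<mu>. SUP i. \<integral>\<^sup>+x. U i x * indicator D x \<partial>\<mu>) \<in> ?B"
    proof (rule measurable_cong)
      fix \<mu> assume \<mu>: "\<mu> \<in> space (locally_finite_algebra Bb)"
      have "(\<integral>\<^sup>+x. (SUP i. U i) x * indicator D x \<partial>\<mu>) = (\<integral>\<^sup>+x. (SUP i. U i x * indicator D x) \<partial>\<mu>)"
        by (simp add: SUP_mult_right_ennreal image_comp)
      also have "\<dots> = (SUP i. \<integral>\<^sup>+x. U i x * indicator D x \<partial>\<mu>)"
      proof (rule nn_integral_monotone_convergence_SUP)
        show "incseq (\<lambda>i x. U i x * indicator D x)"
          using \<open>incseq U\<close> by (auto simp: incseq_def le_fun_def intro!: mult_right_mono)
        have [measurable]: "U i \<in> borel_measurable \<mu>" "D \<in> sets \<mu>" for i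
          by (rule m[OF \<mu> seq.hyps(1)], rule mD[OF \<mu>])
        show "(\<lambda>x. U i x * indicator D x) \<in> borel_measurable \<mu>" for i
          by measurable
      qed
      finally show "(\<integral>\<^sup>+x. (SUP i. U i) x * indicator D x \<partial>\<mu>) = (SUP i. \<integral>\<^sup>+x. U i x * indicator D x \<partial>\<mu>)" .
    qed
    then show ?case using seq.IH by simp
  qed
qed

text \<open>For nonnegative \<open>f\<close> the Bochner integral is the real part of the
  nonnegative integral, and inserting the indicator of the bounded support changes nothing.\<close>

lemma measurable_integral_CB_plus:
  assumes Bb: "boundedness Bb" and f: "f \<in> CB_plus Bb"
  shows "(\<lambda>\<mu>. \<integral>x. f x \<partial>\<mu>) \<in> borel_measurable (locally_finite_algebra Bb)"
proof -
  let ?D = "closure {x. f x \<noteq> 0}"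
  have D: "?D \<in> Bb" using f by (simp add: CB_plus_def)
  have "(\<lambda>\<mu>. enn2real (\<integral>\<^sup>+x. ennreal (f x) * indicator ?D x \<partial>\<mu>)) \<in> borel_measurable (locally_finite_algebra Bb)"
    using CB_plus_measurable[OF f]
    by (intro measurable_compose[OF measurable_nn_integral_locally_finite[OF Bb D]]) auto
  also have "?this \<longleftrightarrow> ?thesis"
  proof (rule measurable_cong)
    fix \<mu> assume "\<mu> \<in> space (locally_finite_algebra Bb)"
    then have "\<mu> \<in> locally_finite_measures Bb"
      using D by (subst (asm) space_locally_finite_algebra) auto
    then have "f \<in> borel_measurable \<mu>"
      using CB_plus_measurable[OF f] by (simp add: measurable_cong_sets[OF sets_locally_finite refl])
    then have "(\<integral>x. f x \<partial>\<mu>) = enn2real (\<integral>\<^sup>+x. ennreal (f x) \<partial>\<mu>)"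
      using CB_plus_nonneg[OF f] by (intro integral_eq_nn_integral) auto
    also have "(\<integral>\<^sup>+x. ennreal (f x) \<partial>\<mu>) = (\<integral>\<^sup>+x. ennreal (f x) * indicator ?D x \<partial>\<mu>)"
    proof (rule nn_integral_cong)
      fix x
      show "ennreal (f x) = ennreal (f x) * indicator ?D x"
        using subsetD[OF closure_subset, of x "{x. f x \<noteq> 0}"] by (cases "f x = 0") auto
    qed
    finally show "enn2real (\<integral>\<^sup>+x. ennreal (f x) * indicator ?D x \<partial>\<mu>) = (\<integral>x. f x \<partial>\<mu>)" ..
  qed
  finally show ?thesis .
qed

section \<open>Continuity and sequential limits in the vague topology\<close>

lemma zero_CB_plus: "{} \<in> Bb \<Longrightarrow> (\<lambda>_. 0) \<in> CB_plus Bb"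
  by (auto simp: CB_plus_def)

text \<open>The zero function with \<open>U = UNIV\<close> contributes the whole set of locally
  finite measures as a subbasic set.\<close>

lemma topspace_vague: "{} \<in> Bb \<Longrightarrow> topspace (vague_topology Bb) = locally_finite_measures Bb"
  unfolding vague_topology_def topology_generated_by_topspace
  using zero_CB_plus[of Bb] by (auto 4 4 intro!: exI[of _ UNIV])

lemma continuous_map_vague_integral:
  assumes "{} \<in> Bb" "f \<in> CB_plus Bb"
  shows "continuous_map (vague_topology Bb) euclideanreal (\<lambda>\<mu>. \<integral>x. f x \<partial>\<mu>)"
  unfolding continuous_map
proof (intro conjI allI impI)
  fix U :: "real set" assume "openin euclideanreal U"
  then have "openin (vague_topology Bb) {\<mu> \<in> locally_finite_measures Bb. (\<integral>x. f x \<partial>\<mu>) \<in> U}"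
    unfolding vague_topology_def using assms(2) by (intro topology_generated_by_Basis) auto
  then show "openin (vague_topology Bb) {\<mu> \<in> topspace (vague_topology Bb). (\<integral>x. f x \<partial>\<mu>) \<in> U}"
    by (simp add: topspace_vague[OF assms(1)])
qed simp

text \<open>Eventual membership holds for subbasic neighbourhoods by \<open>lim\<close> and passes
  to finite intersections and to unions.\<close>

lemma limitin_vague:
  assumes "{} \<in> Bb" "\<mu> \<in> locally_finite_measures Bb" "\<And>n. \<mu>s n \<in> locally_finite_measures Bb"
    and lim: "\<And>f. f \<in> CB_plus Bb \<Longrightarrow> (\<lambda>n. \<integral>x. f x \<partial>\<mu>s n) \<longlonglongrightarrow> (\<integral>x. f x \<partial>\<mu>)"
  shows "limitin (vague_topology Bb) \<mu>s \<mu> sequentially"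
  unfolding limitin_def
proof (intro conjI allI impI)
  show "\<mu> \<in> topspace (vague_topology Bb)" using assms topspace_vague by blast
  fix U assume "openin (vague_topology Bb) U \<and> \<mu> \<in> U"
  then have "generate_topology_on {{\<mu> \<in> locally_finite_measures Bb. (\<integral>x. f x \<partial>\<mu>) \<in> U} | f U.
        f \<in> CB_plus Bb \<and> open U} U" "\<mu> \<in> U"
    by (auto simp: vague_topology_def dest: openin_topology_generated_by)
  then show "\<forall>\<^sub>F n in sequentially. \<mu>s n \<in> U"
  proof (induction rule: generate_topology_on.induct)
    case (UN K)
    then obtain k where k: "k \<in> K" "\<mu> \<in> k" by auto
    show ?case by (rule eventually_mono[OF UN.IH[OF k]]) (use k in auto)
  next
    case (Basis W)
    then obtain f U where f: "f \<in> CB_plus Bb" "open U"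
        "W = {\<mu> \<in> locally_finite_measures Bb. (\<integral>x. f x \<partial>\<mu>) \<in> U}" by auto
    show ?case
      by (rule eventually_mono[OF topological_tendstoD[OF lim[OF f(1)] f(2)]])
         (use f Basis assms in auto)
  qed (auto simp: eventually_conj_iff)
qed

subsection \<open>Vague convergence and Laplace functionals\<close>

lemma tendsto_integral_CB_plus_of_products:
  fixes Bb :: "'a::topological_space set set" and g :: "nat \<Rightarrow> 'a \<Rightarrow> real"
  assumes K: "proper_localizing_sequence Bb K"
    and g: "\<And>i. g i \<in> CB_plus Bb"
    and gen: "\<And>x y. (\<And>i. (\<lambda>n. g i (y n)) \<longlonglongrightarrow> g i x) \<Longrightarrow> y \<longlonglongrightarrow> x"
    and h: "\<And>m. \<exists>i. \<exists>\<delta>>0. \<forall>x\<in>K m. \<delta> \<le> g i x"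
    and \<mu>s: "\<And>n. \<mu>s n \<in> locally_finite_measures Bb"
    and \<mu>: "\<mu> \<in> locally_finite_measures Bb"
    and lim: "\<And>i is. (\<lambda>n. \<integral>x. prod_list (map (\<lambda>i. g i x) (i # is)) \<partial>\<mu>s n)
                 \<longlonglongrightarrow> (\<integral>x. prod_list (map (\<lambda>i. g i x) (i # is)) \<partial>\<mu>)"
    and f: "f \<in> CB_plus Bb"
  shows "(\<lambda>n. \<integral>x. f x \<partial>\<mu>s n) \<longlonglongrightarrow> (\<integral>x. f x \<partial>\<mu>)"
proof -
  \<comment> \<open>With \<open>h = g i\<close> bounded below on the support of \<open>f\<close>, write \<open>\<mu>(f) = (h \<mu>)(f / h)\<close>: the
    measures \<open>h \<mu>\<close> are finite and their moments are integrals of products of the \<open>g j\<close>.\<close>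
  define D where "D = closure {x. f x \<noteq> 0}"
  have "D \<in> Bb" using f by (simp add: CB_plus_def D_def)
  then obtain m where m: "D \<subseteq> K m" using K by (auto simp: proper_localizing_sequence_def)
  have oK: "open (K m)" using K by (auto simp: proper_localizing_sequence_def)
  obtain i \<delta> where \<delta>: "0 < \<delta>" "\<And>x. x \<in> K m \<Longrightarrow> \<delta> \<le> g i x" using h[of m] by blast
  obtain b where b: "\<And>j x. \<bar>g j x\<bar> \<le> b j" using CB_plus_bound[OF g] by metis
  obtain B where B: "\<And>x. \<bar>f x\<bar> \<le> B" using CB_plus_bound[OF f] by blast
  have B0: "0 \<le> B" using B[of undefined] by linarith
  have f0: "f x = 0" if "x \<notin> D" for x
  proof (rule ccontr)
    assume "f x \<noteq> 0"
    then have "x \<in> D" unfolding D_def by (intro subsetD[OF closure_subset]) simp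
    then show False using that by contradiction
  qed
  \<comment> \<open>On \<open>D\<close> the denominator is at least \<open>\<delta>\<close>. Off
    \<open>D\<close> the numerator is 0, so the quotient is 0 even where \<open>g i\<close>
    vanishes.\<close>
  define \<phi> where "\<phi> x = f x / g i x" for x
  have f_eq: "g i x * \<phi> x = f x" for x
  proof (cases "x \<in> D")
    case True
    then have "x \<in> K m" using m by (rule subsetD[rotated])
    then have "g i x \<noteq> 0" using \<delta>(1) \<delta>(2)[of x] by linarith
    then show ?thesis by (simp add: \<phi>_def)
  qed (simp add: \<phi>_def f0)
  have \<phi>_bound: "\<bar>\<phi> x\<bar> \<le> B / \<delta>" for x
  proof (cases "x \<in> D")
    case True
    then have "x \<in> K m" using m by (rule subsetD[rotated])
    then have "\<delta> \<le> g i x" by (rule \<delta>(2))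
    then show ?thesis using B[of x] \<delta>(1) by (auto simp: \<phi>_def abs_divide intro!: frac_le)
  qed (use f0 B0 \<delta> in \<open>auto simp: \<phi>_def\<close>)
  have cf: "continuous_on UNIV f" and cg: "continuous_on UNIV (g i)"
    using f g by (auto simp: CB_plus_def)
  \<comment> \<open>Gluing over two open sets that cover the space: on \<open>K m\<close> the
    denominator stays away from 0, and off the closed set \<open>D\<close> the quotient is
    identically 0.\<close>
  have "continuous_on (K m \<union> - D) \<phi>"
  proof (rule continuous_on_open_Un)
    show "continuous_on (K m) \<phi>"
      unfolding \<phi>_def using \<delta>
      by (intro continuous_on_divide continuous_on_subset[OF cf] continuous_on_subset[OF cg]) force+
    have "continuous_on (- D) (\<lambda>_. 0 :: real)" by simp
    then show "continuous_on (- D) \<phi>"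
      by (rule continuous_on_eq) (use f0 in \<open>auto simp: \<phi>_def\<close>)
  qed (use oK in \<open>auto simp: D_def\<close>)
  moreover have "K m \<union> - D = UNIV" using m by auto
  ultimately have \<phi>: "continuous_on UNIV \<phi>" by simp
  have gb: "g j \<in> borel_measurable \<nu>" if "\<nu> \<in> locally_finite_measures Bb" for j \<nu>
    using that CB_plus_measurable[OF g] by (simp add: measurable_cong_sets[OF sets_locally_finite refl])
  have \<phi>b: "\<phi> \<in> borel_measurable \<nu>" if "\<nu> \<in> locally_finite_measures Bb" for \<nu>
    using that borel_measurable_continuous_onI[OF \<phi>]
    by (simp add: measurable_cong_sets[OF sets_locally_finite refl])
  have dens: "(\<integral>x. F x \<partial>density \<nu> (g i)) = (\<integral>x. g i x * F x \<partial>\<nu>)"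
    if "\<nu> \<in> locally_finite_measures Bb" "F \<in> borel_measurable \<nu>" for \<nu> and F :: "'a \<Rightarrow> real"
    using gb[OF that(1)] that(2) CB_plus_nonneg[OF g] by (subst integral_density) auto
  have fin: "finite_measure (density \<nu> (g i))" if \<nu>: "\<nu> \<in> locally_finite_measures Bb" for \<nu>
  proof (rule finite_measureI)
    have "(\<integral>\<^sup>+x. ennreal (g i x) \<partial>\<nu>) = ennreal (\<integral>x. g i x \<partial>\<nu>)"
      using CB_plus_integrable[OF \<nu> g] CB_plus_nonneg[OF g] by (intro nn_integral_eq_integral) auto
    then show "emeasure (density \<nu> (g i)) (space (density \<nu> (g i))) \<noteq> \<infinity>"
      using gb[OF \<nu>] by (simp add: emeasure_density)
  qed
  \<comment> \<open>The density becomes the head of the list, so every moment, the total mass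
    included, is an integral of a nonempty product as in \<open>lim\<close>.\<close>
  have mom: "(\<integral>x. prod_list (map (\<lambda>j. g j x) is) \<partial>density \<nu> (g i))
      = (\<integral>x. prod_list (map (\<lambda>j. g j x) (i # is)) \<partial>\<nu>)"
    if "\<nu> \<in> locally_finite_measures Bb" for \<nu> "is"
    using borel_measurable_prod_list[of "\<lambda>x j. g j x" \<nu> "is"] gb[OF that]
    by (subst dens[OF that]) auto
  have "(\<lambda>n. \<integral>x. \<phi> x \<partial>density (\<mu>s n) (g i)) \<longlonglongrightarrow> (\<integral>x. \<phi> x \<partial>density \<mu> (g i))"
  proof (rule moments_imp_integral_tendsto[where S = UNIV and g = g and b = b and c = "B / \<delta>"
        and Xs = "\<lambda>_ x. x" and X = "\<lambda>x. x"])
    fix x y assume "\<And>i. (\<lambda>n. g i (y n)) \<longlonglongrightarrow> g i x"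
    then have "y \<longlonglongrightarrow> x" by (rule gen)
    then show "(\<lambda>n. \<phi> (y n)) \<longlonglongrightarrow> \<phi> x"
      using continuous_on_tendsto_compose[OF \<phi>] by auto
  next
    fix "is"
    show "(\<lambda>n. \<integral>x. prod_list (map (\<lambda>j. g j x) is) \<partial>density (\<mu>s n) (g i))
        \<longlonglongrightarrow> (\<integral>x. prod_list (map (\<lambda>j. g j x) is) \<partial>density \<mu> (g i))"
      unfolding mom[OF \<mu>s] mom[OF \<mu>] by (rule lim)
  qed (use fin \<mu>s \<mu> gb b \<phi>_bound in auto)
  then show ?thesis
    by (simp add: dens \<mu> \<mu>s \<phi>b f_eq)
qed

section \<open>Convergence in distribution through Laplace functionals\<close>

theorem proposition4p5:
  fixes Bb :: "'a::polish_space set set"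
    and K :: "nat \<Rightarrow> 'a set"
    and P :: "'v measure" and N :: "'v \<Rightarrow> 'a measure"
    and Ps :: "nat \<Rightarrow> 'w measure" and Ns :: "nat \<Rightarrow> 'w \<Rightarrow> 'a measure"
    and \<C> :: "('a \<Rightarrow> real) set"
  assumes "properly_localizes Bb"
    and "proper_localizing_sequence Bb K"
    and "random_measure Bb P N"
    and "\<And>n. random_measure Bb (Ps n) (Ns n)"
    and "\<C> \<subseteq> CB_plus Bb"
    and "\<And>f g \<alpha> \<beta>. f \<in> \<C> \<Longrightarrow> g \<in> \<C> \<Longrightarrow> 0 \<le> \<alpha> \<Longrightarrow> 0 \<le> \<beta> \<Longrightarrow> (\<lambda>x. \<alpha> * f x + \<beta> * g x) \<in> \<C>"
    and "\<And>f g. f \<in> \<C> \<Longrightarrow> g \<in> \<C> \<Longrightarrow> (\<lambda>x. f x * g x) \<in> \<C>"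
    and "(open :: 'a set \<Rightarrow> bool) =
           generate_topology {f -` U | f U. f \<in> \<C> \<and> openin (top_of_set {0..}) U}"
    and "\<And>m. \<exists>\<delta>>0. \<exists>h\<in>\<C>. \<forall>x. \<delta> * indicator (K m) x \<le> h x"
  shows "converges_in_distribution (vague_topology Bb) Ps Ns P N \<longleftrightarrow>
         (\<forall>f\<in>\<C>. (\<lambda>n. \<integral>\<omega>. exp (- (\<integral>x. f x \<partial>Ns n \<omega>)) \<partial>Ps n)
                   \<longlonglongrightarrow> (\<integral>\<omega>. exp (- (\<integral>x. f x \<partial>N \<omega>)) \<partial>P))"
proof -
  let ?M = "locally_finite_measures Bb"
  have bdd: "boundedness Bb"
    using assms(1) by (simp add: properly_localizes_def proper_boundedness_def)
  have empty: "{} \<in> Bb"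
    using assms(2) by (auto simp: proper_localizing_sequence_def)
  note top = topspace_vague[OF empty]
  have space: "space (locally_finite_algebra Bb) = ?M"
    by (rule space_locally_finite_algebra) (use empty in auto)
  have CB: "f \<in> CB_plus Bb" if "f \<in> \<C>" for f
    using assms(5) that by auto
  show ?thesis
  proof (intro iffI ballI)
    fix f assume conv: "converges_in_distribution (vague_topology Bb) Ps Ns P N" and f: "f \<in> \<C>"
    \<comment> \<open>The Laplace functional is itself the expectation of an admissible test
      function, continuous with values between 0 and 1.\<close>
    have "continuous_map (vague_topology Bb) euclideanreal (\<lambda>\<mu>. exp (- (\<integral>x. f x \<partial>\<mu>)))"
      using continuous_map_compose[OF continuous_map_vague_integral[OF empty CB[OF f]],
          of euclideanreal "\<lambda>r. exp (- r)"]
      by (simp add: o_def continuous_intros)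
    moreover have "bounded ((\<lambda>\<mu>. exp (- (\<integral>x. f x \<partial>\<mu>))) ` topspace (vague_topology Bb))"
      using CB_plus_nonneg[OF CB[OF f]] by (auto simp: bounded_iff intro!: exI[of _ 1] integral_nonneg_AE)
    ultimately show "(\<lambda>n. \<integral>\<omega>. exp (- (\<integral>x. f x \<partial>Ns n \<omega>)) \<partial>Ps n)
        \<longlonglongrightarrow> (\<integral>\<omega>. exp (- (\<integral>x. f x \<partial>N \<omega>)) \<partial>P)"
      using conv unfolding converges_in_distribution_def by blast
  next
    assume laplace: "\<forall>f\<in>\<C>. (\<lambda>n. \<integral>\<omega>. exp (- (\<integral>x. f x \<partial>Ns n \<omega>)) \<partial>Ps n)
        \<longlonglongrightarrow> (\<integral>\<omega>. exp (- (\<integral>x. f x \<partial>N \<omega>)) \<partial>P)"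
    obtain G where G: "countable G" "G \<subseteq> \<C>"
      "\<And>x y. (\<And>f. f \<in> G \<Longrightarrow> (\<lambda>n. f (y n)) \<longlonglongrightarrow> f x) \<Longrightarrow> y \<longlonglongrightarrow> x"
      using countable_generating_subfamily[OF assms(8)] CB_plus_nonneg[OF CB] by blast
    obtain \<delta> h where h: "\<And>m. 0 < \<delta> m" "\<And>m. h m \<in> \<C>" "\<And>m x. \<delta> m * indicator (K m) x \<le> h m x"
      using assms(9) by metis
    \<comment> \<open>\<open>G\<close> makes the sequence generate the topology; the functions
      \<open>h m\<close> provide lower bounds on each \<open>K m\<close> and also make the
      enumerated set nonempty.\<close>
    define g where "g = from_nat_into (G \<union> range h)"
    have rg: "range g = G \<union> range h"
      unfolding g_def by (rule range_from_nat_into) (use G in auto)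
    have "G \<union> range h \<subseteq> \<C>" using G(2) h(2) by auto
    then have gC: "g i \<in> \<C>" for i unfolding rg[symmetric] by auto
    have gen: "y \<longlonglongrightarrow> x" if "\<And>i. (\<lambda>n. g i (y n)) \<longlonglongrightarrow> g i x" for x y
    proof (rule G(3))
      fix f assume "f \<in> G"
      then have "f \<in> range g" by (simp add: rg)
      then obtain i where "f = g i" ..
      then show "(\<lambda>n. f (y n)) \<longlonglongrightarrow> f x" using that by simp
    qed
    have gh: "\<exists>i. \<exists>\<delta>>0. \<forall>x\<in>K m. \<delta> \<le> g i x" for m
    proof -
      have "h m \<in> range g" by (simp add: rg)
      then obtain i where i: "h m = g i" ..
      have "\<delta> m \<le> g i x" if "x \<in> K m" for x
        using h(3)[of m x] that by (simp add: i)
      then show ?thesis using h(1)[of m] by blast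
    qed
    \<comment> \<open>Only nonempty products: the constant \<open>1\<close> need not belong to \<open>\<C>\<close>.\<close>
    define c where "c j = (case from_nat j of (i, is) \<Rightarrow> \<lambda>x. prod_list (map (\<lambda>i. g i x) (i # is)))"
      for j :: nat
    have prodC: "(\<lambda>x. prod_list (map (\<lambda>i. g i x) (i # is))) \<in> \<C>" for i "is"
    proof (induction "is" arbitrary: i)
      case Nil
      then show ?case using gC by simp
    next
      case (Cons j "is")
      show ?case using assms(7)[OF gC[of i] Cons.IH[of j]] by simp
    qed
    have cC: "c j \<in> \<C>" for j
    proof -
      obtain i :: nat and "is" :: "nat list" where "from_nat j = (i, is)" by (rule prod.exhaust)
      then have cj: "c j = (\<lambda>x. prod_list (map (\<lambda>i. g i x) (i # is)))" by (simp add: c_def)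
      show ?thesis unfolding cj by (rule prodC)
    qed
    have c_to_nat: "c (to_nat (i, is)) = (\<lambda>x. prod_list (map (\<lambda>i. g i x) (i # is)))" for i "is"
      by (simp add: c_def)
    \<comment> \<open>With all coefficients 0 this yields the value of the empty sum, which
      corresponds to the empty moment.\<close>
    have zero: "(\<lambda>_. 0) \<in> \<C>" using assms(6)[OF h(2) h(2), of 0 0 0 0] by simp
    have sumC: "(\<lambda>x. \<Sum>j\<leftarrow>js. c j x) \<in> \<C>" for js
    proof (induction js)
      case (Cons j js)
      show ?case using assms(6)[OF cC[of j] Cons.IH, of 1 1] by simp
    qed (simp add: zero)
    \<comment> \<open>A moment of the functions \<open>exp (- \<mu>(c j))\<close> is the exponential
      for a sum of functions \<open>c j\<close>. Such sums remain in \<C>, so \<open>laplace\<close>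
      supplies the convergence of all moments.\<close>
    have exp_sum: "prod_list (map (\<lambda>j. exp (- (\<integral>x. c j x \<partial>\<mu>))) js) = exp (- (\<integral>x. (\<Sum>j\<leftarrow>js. c j x) \<partial>\<mu>))"
      if "\<mu> \<in> ?M" for js \<mu>
    proof (induction js)
      case (Cons j js)
      then show ?case
        using CB_plus_integrable[OF that CB[OF cC]] CB_plus_integrable[OF that CB[OF sumC]]
        by (simp add: exp_add[symmetric])
    qed simp
    have prob: "prob_space P" "\<And>n. prob_space (Ps n)"
      and NM: "N \<in> P \<rightarrow>\<^sub>M locally_finite_algebra Bb" "\<And>n. Ns n \<in> Ps n \<rightarrow>\<^sub>M locally_finite_algebra Bb"
      using assms(3,4) by (auto simp: random_measure_def)
    have NS: "\<And>\<omega>. \<omega> \<in> space P \<Longrightarrow> N \<omega> \<in> ?M" "\<And>n \<omega>. \<omega> \<in> space (Ps n) \<Longrightarrow> Ns n \<omega> \<in> ?M"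
      using measurable_space[OF NM(1)] measurable_space[OF NM(2)] space by auto
    have ne: "?M \<noteq> {}" using prob_space.not_empty[OF prob(1)] NS by auto
    note mc = measurable_integral_CB_plus[OF bdd CB[OF cC]]
    show "converges_in_distribution (vague_topology Bb) Ps Ns P N"
      unfolding converges_in_distribution_def
    proof (intro allI impI)
      fix \<phi>
      assume \<phi>: "continuous_map (vague_topology Bb) euclideanreal \<phi>" "bounded (\<phi> ` topspace (vague_topology Bb))"
      obtain B where B: "\<And>\<mu>. \<mu> \<in> ?M \<Longrightarrow> \<bar>\<phi> \<mu>\<bar> \<le> B"
        using \<phi>(2) unfolding top by (auto simp: bounded_iff)
      show "(\<lambda>n. \<integral>\<omega>. \<phi> (Ns n \<omega>) \<partial>Ps n) \<longlonglongrightarrow> (\<integral>\<omega>. \<phi> (N \<omega>) \<partial>P)"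
      proof (rule moments_imp_integral_tendsto[where S = ?M and b = "\<lambda>_. 1" and c = B
            and g = "\<lambda>j \<mu>. exp (- (\<integral>x. c j x \<partial>\<mu>))"])
        fix js
        have *: "(\<integral>\<omega>. prod_list (map (\<lambda>j. exp (- (\<integral>x. c j x \<partial>Y \<omega>))) js) \<partial>Q)
            = (\<integral>\<omega>. exp (- (\<integral>x. (\<Sum>j\<leftarrow>js. c j x) \<partial>Y \<omega>)) \<partial>Q)"
          if "\<And>\<omega>. \<omega> \<in> space Q \<Longrightarrow> Y \<omega> \<in> ?M" for Y and Q :: "'z measure"
          by (rule Bochner_Integration.integral_cong[OF refl]) (rule exp_sum[OF that])
        show "(\<lambda>n. \<integral>\<omega>. prod_list (map (\<lambda>j. exp (- (\<integral>x. c j x \<partial>Ns n \<omega>))) js) \<partial>Ps n)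
            \<longlonglongrightarrow> (\<integral>\<omega>. prod_list (map (\<lambda>j. exp (- (\<integral>x. c j x \<partial>N \<omega>))) js) \<partial>P)"
          using laplace sumC by (simp add: * NS)
      next
        \<comment> \<open>Sequential continuity of \<open>\<phi>\<close>: taking logarithms gives
          convergence of the integrals of all nonempty products of the \<open>g i\<close>, hence of
          all of \<open>CB_plus Bb\<close>, hence vague convergence, along which a continuous
          \<open>\<phi>\<close> converges.\<close>
        fix \<mu> \<mu>s
        assume \<mu>: "\<mu> \<in> ?M" and \<mu>s: "\<And>n. \<mu>s n \<in> ?M"
          and lim: "\<And>j. (\<lambda>n. exp (- (\<integral>x. c j x \<partial>\<mu>s n))) \<longlonglongrightarrow> exp (- (\<integral>x. c j x \<partial>\<mu>))"
        have "(\<lambda>n. \<integral>x. c j x \<partial>\<mu>s n) \<longlonglongrightarrow> (\<integral>x. c j x \<partial>\<mu>)" for j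
          using tendsto_minus[OF tendsto_ln[OF lim[of j]]] by simp
        then have prods: "(\<lambda>n. \<integral>x. prod_list (map (\<lambda>i. g i x) (i # is)) \<partial>\<mu>s n)
            \<longlonglongrightarrow> (\<integral>x. prod_list (map (\<lambda>i. g i x) (i # is)) \<partial>\<mu>)" for i "is"
          unfolding c_to_nat[symmetric] .
        have "limitin (vague_topology Bb) \<mu>s \<mu> sequentially"
        proof (rule limitin_vague[OF empty \<mu> \<mu>s])
          fix f assume f: "f \<in> CB_plus Bb"
          show "(\<lambda>n. \<integral>x. f x \<partial>\<mu>s n) \<longlonglongrightarrow> (\<integral>x. f x \<partial>\<mu>)"
            by (rule tendsto_integral_CB_plus_of_products[OF assms(2) CB[OF gC] _ gh \<mu>s \<mu> prods f])
               (rule gen)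
        qed
        from continuous_map_limit[OF \<phi>(1) this]
        show "(\<lambda>n. \<phi> (\<mu>s n)) \<longlonglongrightarrow> \<phi> \<mu>" by (simp add: o_def)
      next
        show "(\<lambda>\<omega>. exp (- (\<integral>x. c i x \<partial>N \<omega>))) \<in> borel_measurable P" for i
          using measurable_compose[OF NM(1) mc[of i]] by measurable
        show "(\<lambda>\<omega>. exp (- (\<integral>x. c i x \<partial>Ns n \<omega>))) \<in> borel_measurable (Ps n)" for i n
          using measurable_compose[OF NM(2) mc[of i]] by measurable
        show "\<bar>exp (- (\<integral>x. c i x \<partial>\<mu>))\<bar> \<le> 1" for i \<mu>
          using CB_plus_nonneg[OF CB[OF cC]] by (auto intro!: integral_nonneg_AE)
      qed (use ne NS B prob in \<open>auto intro: prob_space.finite_measure\<close>)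
    qed
  qed
qed

end
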